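(* Let $w(x_1,x_2)=(1-x_1^2)^{-1/2}(1-x_2^2)^{-1/2}$ on $\mathcal{S}=[-1,1]\times[-1,1]$ (i.e. $\alpha_i=\beta_i=-\frac12$, $i=1,2$), and let $f:\mathcal{S}\to\mathbb{R}$ be such that $fw$ is integrable and the coefficients $\alpha_{i,j}$ of its orthogonal expansion converge to zero sufficiently rapidly (in the sense specified in the context). If, for $n_1$ and $n_2$ large enough, $$|\theta_{n_1,n_2}|<|\alpha_{2n_1,0}+\alpha_{0,2n_2}|,$$ where $$\begin{aligned} |\theta_{n_1,n_2}|=&\ \sqrt2\,|\alpha_{2n_1,2n_2}|+\sum_{k_1=2}^\infty\left(|\alpha_{2n_1k_1,0}|+\sqrt2\,|\alpha_{2n_1k_1,2n_2}|\right)\\ &+\sqrt2\sum_{k_1=2}^\infty\sum_{k_2=2}^\infty|\alpha_{2n_1k_1,2n_2k_2}|+\sum_{k_2=2}^\infty\left(|\alpha_{0,2n_2k_2}|+\sqrt2\,|\alpha_{2n_1,2n_2k_2}|\right), \end{aligned}$$ then, for such $n_1,n_2$, either $$\mathcal{G}_{n_1,n_2}(f)\le\mathcal{I}(f)\le\mathcal{A}_{n_1+1,n_2+1}(f)\qquad\text{or}\qquad\mathcal{A}_{n_1+1,n_2+1}(f)\le\mathcal{I}(f)\le\mathcal{G}_{n_1,n_2}(f).$$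
   Context: $\mathcal{I}(f)=\int_{\mathcal{S}}f(\mathbf{x})w(\mathbf{x})\,d\mathbf{x}$. Let $\pi_n$ ($n\ge0$) be the monic orthogonal polynomials with respect to the first-kind Chebyshev weight $(1-t^2)^{-1/2}$ on $[-1,1]$, with three-term recurrence $\pi_{j+1}(t)=(t-a_j)\pi_j(t)-b_j\pi_{j-1}(t)$, $\pi_{-1}=0$, $\pi_0=1$, $b_0=\int_{-1}^1(1-t^2)^{-1/2}dt=\pi$ (the number), and let $p_n$ be the corresponding orthonormal polynomials. The orthogonal expansion of $f$ is $f(\mathbf{x})=\sum_{i=0}^\infty\sum_{j=0}^\infty\alpha_{i,j}\,p_i(x_1)p_j(x_2)$ with $\alpha_{i,j}=\int_{\mathcal{S}}f(\mathbf{x})p_i(x_1)p_j(x_2)w(\mathbf{x})\,d\mathbf{x}$. For $n\ge1$, the $n$-point Gauss rule for $(1-t^2)^{-1/2}$ has as nodes the zeros of $\pi_n$ and as weights the Christoffel numbers. The $(n+1)$-point anti-Gauss rule has as nodes the zeros of $\pi_{n+1}-b_n\pi_{n-1}$, i.e. the eigenvalues of the symmetric tridiagonal matrix with diagonal $a_0,\dots,a_n$ and off-diagonal $\sqrt{b_1},\dots,\sqrt{b_{n-1}},\sqrt{2b_n}$, and its weights are $b_0$ times the squared first components of the normalized eigenvectors; all nodes lie in $[-1,1]$. $\mathcal{G}_{n_1,n_2}$ is the tensor product of the $n_1$-point Gauss rule in $x_1$ and the $n_2$-point Gauss rule in $x_2$; $\mathcal{A}_{n_1+1,n_2+1}$ is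 the tensor product of the $(n_1+1)$-point anti-Gauss rule in $x_1$ and the $(n_2+1)$-point anti-Gauss rule in $x_2$. "The coefficients converge to zero sufficiently rapidly" means: at every node of the rules $\mathcal{G}_{n_1,n_2}$ and $\mathcal{A}_{n_1+1,n_2+1}$ considered, the double series of the expansion converges absolutely and its sum is the value of $f$ there. *)

theory Defs
  imports "HOL-Analysis.Analysis" "HOL-Computational_Algebra.Polynomial"
    "Jordan_Normal_Form.Char_Poly"
begin

definition cheb_weight :: "real \<Rightarrow> real" where
  "cheb_weight t = (1 - t\<^sup>2) powr (- 1 / 2)"

definition square :: "(real \<times> real) set" where
  "square = {-1..1} \<times> {-1..1}"

definition weight2 :: "real \<times> real \<Rightarrow> real" where
  "weight2 x = cheb_weight (fst x) * cheb_weight (snd x)"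

definition weighted_integral :: "(real \<times> real \<Rightarrow> real) \<Rightarrow> real" where
  "weighted_integral f = (LINT x:square|lebesgue. f x * weight2 x)"


definition cheb_inner :: "real poly \<Rightarrow> real poly \<Rightarrow> real" where
  "cheb_inner p q = (LINT t:{-1..1}|lebesgue. poly p t * poly q t * cheb_weight t)"

definition monic_orthogonal :: "(nat \<Rightarrow> real poly) \<Rightarrow> bool" where
  "monic_orthogonal P \<longleftrightarrow>
     (\<forall>n. degree (P n) = n \<and> lead_coeff (P n) = 1) \<and>
     (\<forall>m n. m \<noteq> n \<longrightarrow> cheb_inner (P m) (P n) = 0)"

definition monic_op :: "nat \<Rightarrow> real poly" where
  "monic_op = (THE P. monic_orthogonal P)"

definition orthonormal_op :: "nat \<Rightarrow> real poly" where
  "orthonormal_op n = Polynomial.smult (1 / sqrt (cheb_inner (monic_op n) (monic_op n))) (monic_op n)"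

definition three_term_recurrence :: "(nat \<Rightarrow> real) \<Rightarrow> (nat \<Rightarrow> real) \<Rightarrow> bool" where
  "three_term_recurrence a b \<longleftrightarrow>
     b 0 = (LINT t:{-1..1}|lebesgue. cheb_weight t) \<and>
     (\<forall>j. monic_op (Suc j) =
        [:- a j, 1:] * monic_op j - Polynomial.smult (b j) (if j = 0 then 0 else monic_op (j - 1)))"

(* The recurrence determines all a_j and, since the j = 0 instance does not involve b_0,
   the b_j with j >= 1; b_0 is fixed by its own equation. *)
definition rec_coeffs :: "(nat \<Rightarrow> real) \<times> (nat \<Rightarrow> real)" where
  "rec_coeffs = (THE ab. three_term_recurrence (fst ab) (snd ab))"

definition rec_a :: "nat \<Rightarrow> real" where
  "rec_a = fst rec_coeffs"

definition rec_b :: "nat \<Rightarrow> real" where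
  "rec_b = snd rec_coeffs"


definition exp_coeff :: "(real \<times> real \<Rightarrow> real) \<Rightarrow> nat \<Rightarrow> nat \<Rightarrow> real" where
  "exp_coeff f i j =
     (LINT x:square|lebesgue.
        f x * poly (orthonormal_op i) (fst x) * poly (orthonormal_op j) (snd x) * weight2 x)"

definition expansion_converges_at :: "(real \<times> real \<Rightarrow> real) \<Rightarrow> real \<times> real \<Rightarrow> bool" where
  "expansion_converges_at f x \<longleftrightarrow>
     (let s = (\<lambda>(i, j). exp_coeff f i j * poly (orthonormal_op i) (fst x)
                                       * poly (orthonormal_op j) (snd x))
      in (\<lambda>k. \<bar>s k\<bar>) summable_on UNIV \<and> (s has_sum f x) UNIV)"


definition gauss_nodes :: "nat \<Rightarrow> real set" where
  "gauss_nodes n = {x. poly (monic_op n) x = 0}"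

(* Christoffel number of a node x: the value at x of the n-th Christoffel function. *)
definition christoffel :: "nat \<Rightarrow> real \<Rightarrow> real" where
  "christoffel n x = 1 / (\<Sum>j<n. (poly (orthonormal_op j) x)\<^sup>2)"

(* The index n of the anti-Gauss notions belongs to the rule with n + 1 points, n >= 1. *)
definition anti_gauss_nodes :: "nat \<Rightarrow> real set" where
  "anti_gauss_nodes n =
     {x. poly (monic_op (n + 1) - Polynomial.smult (rec_b n) (monic_op (n - 1))) x = 0}"

definition anti_gauss_matrix :: "nat \<Rightarrow> real mat" where
  "anti_gauss_matrix n = mat (n + 1) (n + 1) (\<lambda>(i, j).
     if i = j then rec_a i
     else if i = j + 1 \<or> j = i + 1 then
       (if max i j = n then sqrt (2 * rec_b n) else sqrt (rec_b (max i j)))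
     else 0)"

(* The off-diagonal entries are nonzero, so each eigenvalue is simple and the normalized
   eigenvector is unique up to sign. *)
definition anti_gauss_weight :: "nat \<Rightarrow> real \<Rightarrow> real" where
  "anti_gauss_weight n x =
     (THE c. \<exists>v. eigenvector (anti_gauss_matrix n) v x \<and> scalar_prod v v = 1 \<and>
                 c = rec_b 0 * (vec_index v 0)\<^sup>2)"

definition gauss_cubature :: "nat \<Rightarrow> nat \<Rightarrow> (real \<times> real \<Rightarrow> real) \<Rightarrow> real" where
  "gauss_cubature n1 n2 f =
     (\<Sum>x\<in>gauss_nodes n1. \<Sum>y\<in>gauss_nodes n2. christoffel n1 x * christoffel n2 y * f (x, y))"

definition anti_gauss_cubature :: "nat \<Rightarrow> nat \<Rightarrow> (real \<times> real \<Rightarrow> real) \<Rightarrow> real" where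
  "anti_gauss_cubature n1 n2 f =
     (\<Sum>x\<in>anti_gauss_nodes n1. \<Sum>y\<in>anti_gauss_nodes n2.
        anti_gauss_weight n1 x * anti_gauss_weight n2 y * f (x, y))"

definition coeffs_rapidly_vanish :: "(real \<times> real \<Rightarrow> real) \<Rightarrow> nat \<Rightarrow> nat \<Rightarrow> bool" where
  "coeffs_rapidly_vanish f n1 n2 \<longleftrightarrow>
     (\<forall>x \<in> gauss_nodes n1 \<times> gauss_nodes n2 \<union> anti_gauss_nodes n1 \<times> anti_gauss_nodes n2.
        expansion_converges_at f x)"

(* The quantity |theta_{n1,n2}|. All sums converge under coeffs_rapidly_vanish f n1 n2, because
   (1, 1) is an anti-Gauss node and the values p_n(1) are bounded away from 0. *)
definition abs_theta :: "(real \<times> real \<Rightarrow> real) \<Rightarrow> nat \<Rightarrow> nat \<Rightarrow> real" where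
  "abs_theta f n1 n2 =
     (let \<alpha> = exp_coeff f in
        sqrt 2 * \<bar>\<alpha> (2 * n1) (2 * n2)\<bar>
      + (\<Sum>\<^sub>\<infinity>k1\<in>{2..}. \<bar>\<alpha> (2 * n1 * k1) 0\<bar> + sqrt 2 * \<bar>\<alpha> (2 * n1 * k1) (2 * n2)\<bar>)
      + sqrt 2 * (\<Sum>\<^sub>\<infinity>k1\<in>{2..}. \<Sum>\<^sub>\<infinity>k2\<in>{2..}. \<bar>\<alpha> (2 * n1 * k1) (2 * n2 * k2)\<bar>)
      + (\<Sum>\<^sub>\<infinity>k2\<in>{2..}. \<bar>\<alpha> 0 (2 * n2 * k2)\<bar> + sqrt 2 * \<bar>\<alpha> (2 * n1) (2 * n2 * k2)\<bar>))"

end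

theory Submission
  imports Defs
begin

text \<open>
  Write \<open>s 0 = 1\<close> and \<open>s k = sqrt 2\<close> for \<open>k \<ge> 1\<close>. With \<open>t = cos \<theta>\<close> the weight becomes \<open>d\<theta>\<close>, the orthonormal
  polynomials become \<open>s i * cos (i \<theta>) / sqrt \<pi>\<close>, the \<open>n\<close>-point Gauss rule becomes the midpoint rule, and
  the \<open>n + 1\<close>-point anti-Gauss rule the trapezoidal rule, both with step \<open>\<pi> / n\<close>. On \<open>cos (i \<theta>)\<close> either
  rule gives \<open>0\<close> unless \<open>i = 2 n k\<close> (\<open>midpoint_sum\<close>, \<open>trapezoid_sum\<close>), and then the midpoint rule gives
  \<open>(-1) ^ k * \<pi>\<close> and the trapezoidal rule \<open>\<pi>\<close>.

  Applied term by term to the expansion of \<open>f\<close>, the cubature rules are therefore \<open>\<pi>\<close> times the sum of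
  \<open>\<epsilon> ^ (k + l) * s k * s l * \<alpha> (2 n1 k) (2 n2 l)\<close> with \<open>\<epsilon> = -1\<close> for Gauss and \<open>\<epsilon> = 1\<close> for anti-Gauss. The
  term \<open>k = l = 0\<close> is the integral. The terms \<open>(1, 0)\<close> and \<open>(0, 1)\<close> give
  \<open>\<epsilon> * \<pi> * sqrt 2 * (\<alpha> (2 n1) 0 + \<alpha> 0 (2 n2))\<close>, of opposite sign for the two rules, and the absolute
  values of all others add up to \<open>\<pi> * sqrt 2 * \<theta>\<close> (\<open>aliased_series_tail_bound\<close>). If \<open>\<theta>\<close> is smaller than
  \<open>\<bar>\<alpha> (2 n1) 0 + \<alpha> 0 (2 n2)\<bar>\<close>, the two errors have opposite signs, and the integral lies between the
  two values.

  What remains is to identify the objects that are characterised implicitly: the monic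
  orthogonal polynomials (\<open>monic_orthogonal_iff\<close>), the recurrence coefficients
  (\<open>three_term_recurrence_iff\<close>), the nodes as zeros of polynomials, the Christoffel numbers
  (\<open>christoffel_eq\<close>) and the anti-Gauss weights as eigenvector entries (\<open>anti_gauss_weight_eq\<close>).
\<close>

section \<open>Chebyshev polynomials\<close>

fun chebyshev_T :: "nat \<Rightarrow> real poly" where
  "chebyshev_T 0 = 1"
| "chebyshev_T (Suc 0) = [:0, 1:]"
| "chebyshev_T (Suc (Suc n)) = [:0, 2:] * chebyshev_T (Suc n) - chebyshev_T n"

lemma poly_chebyshev_T_cos: "poly (chebyshev_T n) (cos \<theta>) = cos (real n * \<theta>)"
proof (induction n rule: chebyshev_T.induct)
  case (3 n)
  have "cos (real (Suc n) * \<theta> + \<theta>) + cos (real (Suc n) * \<theta> - \<theta>)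
      = 2 * cos \<theta> * cos (real (Suc n) * \<theta>)"
    by (simp only: cos_add cos_diff) simp
  then show ?case
    using 3 by (simp add: algebra_simps)
qed auto

lemma poly_chebyshev_T_arccos:
  "t \<in> {-1..1} \<Longrightarrow> poly (chebyshev_T n) t = cos (real n * arccos t)"
  using poly_chebyshev_T_cos[of n "arccos t"] by (simp add: cos_arccos)

lemma chebyshev_T_degree_coeff:
  "degree (chebyshev_T n) \<le> n \<and> coeff (chebyshev_T n) n = 2 ^ (n - 1)"
proof (induction n rule: chebyshev_T.induct)
  case (3 n)
  have eq: "chebyshev_T (Suc (Suc n)) = Polynomial.smult 2 (pCons 0 (chebyshev_T (Suc n))) - chebyshev_T n"
    by simp
  have "degree (pCons 0 (chebyshev_T (Suc n))) \<le> Suc (Suc n)"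
    using 3 degree_pCons_le[of 0 "chebyshev_T (Suc n)"] by linarith
  then have "degree (Polynomial.smult 2 (pCons 0 (chebyshev_T (Suc n)))) \<le> Suc (Suc n)"
    by (meson degree_smult_le le_trans)
  then have "degree (chebyshev_T (Suc (Suc n))) \<le> Suc (Suc n)"
    unfolding eq using 3 by (intro degree_diff_le) auto
  moreover have "coeff (chebyshev_T n) (Suc (Suc n)) = 0"
    using 3 by (intro coeff_eq_0) linarith
  then have "coeff (chebyshev_T (Suc (Suc n))) (Suc (Suc n)) = 2 ^ (Suc (Suc n) - 1)"
    unfolding eq using 3 by (simp del: chebyshev_T.simps)
  ultimately show ?case
    by blast
qed (auto simp: coeff_pCons)

text \<open>
  Truncated subtraction makes the exponent \<open>n - 1\<close> vanish at \<open>n = 0\<close>, where the Chebyshev polynomial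
  is already monic.
\<close>

definition monic_chebyshev :: "nat \<Rightarrow> real poly" where
  "monic_chebyshev n = Polynomial.smult (1 / 2 ^ (n - 1)) (chebyshev_T n)"

lemma coeff_monic_chebyshev [simp]: "coeff (monic_chebyshev n) n = 1"
  using chebyshev_T_degree_coeff[of n] by (simp add: monic_chebyshev_def)

lemma degree_monic_chebyshev [simp]: "degree (monic_chebyshev n) = n"
proof (rule antisym)
  show "degree (monic_chebyshev n) \<le> n"
    using chebyshev_T_degree_coeff[of n] by (simp add: monic_chebyshev_def)
  show "n \<le> degree (monic_chebyshev n)"
    by (rule le_degree) simp
qed

section \<open>Orthogonality with respect to the Chebyshev weight\<close>

text \<open>
  Under \<open>t = cos \<theta>\<close> this is the integral of \<open>cos (n \<theta>)\<close> over \<open>[0, \<pi>]\<close>. Instead of substituting in an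
  improper integral, the antiderivative \<open>- sin (n arccos t) / n\<close> (or \<open>- arccos t\<close> for \<open>n = 0\<close>) is used:
  it is continuous on the closed interval, so its derivative is needed in the interior only.
\<close>

lemma has_integral_cos_arccos:
  "((\<lambda>t. cos (real n * arccos t) * cheb_weight t) has_integral (if n = 0 then pi else 0)) {-1..1}"
proof -
  define F where "F t = (if n = 0 then - arccos t else - sin (real n * arccos t) / real n)" for t
  have cont: "continuous_on {-1..1} F"
    unfolding F_def by (cases "n = 0") (auto intro!: continuous_intros continuous_on_arccos')
  have deriv: "(F has_vector_derivative cos (real n * arccos t) * cheb_weight t) (at t)"
    if "t \<in> {-1<..<1}" for t
  proof -
    have t: "- 1 < t" "t < 1" and "0 < 1 - t\<^sup>2"
      using that by (auto simp: abs_square_less_1)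
    have w: "cheb_weight t = 1 / sqrt (1 - t\<^sup>2)"
      using \<open>0 < 1 - t\<^sup>2\<close> by (simp add: cheb_weight_def powr_minus powr_half_sqrt divide_simps)
    have "(F has_field_derivative cos (real n * arccos t) * cheb_weight t) (at t)"
      unfolding F_def w using t
      by (cases "n = 0") (auto intro!: derivative_eq_intros simp: divide_simps)
    then show ?thesis
      by (simp add: has_real_derivative_iff_has_vector_derivative)
  qed
  have "((\<lambda>t. cos (real n * arccos t) * cheb_weight t) has_integral F 1 - F (-1)) {-1..1}"
    by (rule fundamental_theorem_of_calculus_interior[OF _ cont deriv]) auto
  moreover have "F 1 - F (-1) = (if n = 0 then pi else 0)"
    by (simp add: F_def)
  ultimately show ?thesis
    by simp
qed

lemma cheb_weight_absolutely_integrable: "cheb_weight absolutely_integrable_on {-1..1}"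
proof (rule nonnegative_absolutely_integrable_1)
  show "cheb_weight integrable_on {-1..1}"
    using has_integral_cos_arccos[of 0] by (auto simp: integrable_on_def)
qed (simp add: cheb_weight_def)

lemma poly_weight_absolutely_integrable:
  "(\<lambda>t. poly p t * cheb_weight t) absolutely_integrable_on {-1..1}"
proof (rule absolutely_integrable_bounded_measurable_product_real)
  have cont: "continuous_on {-1..1} (poly p)"
    by (intro continuous_intros)
  show "poly p \<in> borel_measurable (lebesgue_on {-1..1})"
    by (rule continuous_imp_measurable_on_sets_lebesgue[OF cont]) auto
  show "bounded (poly p ` {-1..1})"
    by (intro compact_imp_bounded compact_continuous_image cont) auto
qed (use cheb_weight_absolutely_integrable in auto)

lemma poly_weight_integrable:
  "set_integrable lebesgue {-1..1} (\<lambda>t. poly p t * poly q t * cheb_weight t)"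
  using poly_weight_absolutely_integrable[of "p * q"] by simp

lemma cheb_inner_add: "cheb_inner (p + q) r = cheb_inner p r + cheb_inner q r"
  unfolding cheb_inner_def
  by (subst set_integral_add(2)[symmetric])
     (auto simp: algebra_simps intro!: poly_weight_integrable[simplified algebra_simps])

lemma cheb_inner_smult: "cheb_inner (Polynomial.smult c p) r = c * cheb_inner p r"
  unfolding cheb_inner_def
  by (subst set_integral_mult_right[symmetric]) (simp add: algebra_simps)

lemma cheb_inner_commute: "cheb_inner p q = cheb_inner q p"
  unfolding cheb_inner_def by (simp add: mult.commute)

lemma cheb_inner_diff: "cheb_inner (p - q) r = cheb_inner p r - cheb_inner q r"
  using cheb_inner_add[of p "Polynomial.smult (-1) q" r] cheb_inner_smult[of "-1" q r] by simp

lemma cheb_inner_chebyshev_T: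
  "cheb_inner (chebyshev_T m) (chebyshev_T n) = (if m = n then if n = 0 then pi else pi / 2 else 0)"
proof -
  have *: "cheb_inner (chebyshev_T m) (chebyshev_T n)
        = (if m = n then if n = 0 then pi else pi / 2 else 0)" if "n \<le> m" for m n
  proof -
    let ?f = "\<lambda>t. poly (chebyshev_T m) t * poly (chebyshev_T n) t * cheb_weight t"
    have prod: "1 / 2 * (cos (real (m + n) * arccos t) * cheb_weight t
            + cos (real (m - n) * arccos t) * cheb_weight t) = ?f t" if "t \<in> {-1..1}" for t
    proof -
      have "cos (real m * s) * cos (real n * s)
          = (cos (real (m + n) * s) + cos (real (m - n) * s)) / 2" for s
        using \<open>n \<le> m\<close> by (simp add: cos_add cos_diff of_nat_diff distrib_right left_diff_distrib)
      then have "?f t = (cos (real (m + n) * arccos t) + cos (real (m - n) * arccos t)) / 2 * cheb_weight t"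
        by (simp only: poly_chebyshev_T_arccos[OF that])
      then show ?thesis
        by (simp only: times_divide_eq_left times_divide_eq_right distrib_right mult_1)
    qed
    have "((\<lambda>t. 1 / 2 * (cos (real (m + n) * arccos t) * cheb_weight t
            + cos (real (m - n) * arccos t) * cheb_weight t)) has_integral
          1 / 2 * ((if m + n = 0 then pi else 0) + (if m - n = 0 then pi else 0))) {-1..1}"
      by (intro has_integral_mult_right has_integral_add has_integral_cos_arccos)
    then have "(?f has_integral
          1 / 2 * ((if m + n = 0 then pi else 0) + (if m - n = 0 then pi else 0))) {-1..1}"
      using prod by (rule has_integral_eq[rotated])
    then have "integral {-1..1} ?f = (if m = n then if n = 0 then pi else pi / 2 else 0)"
      using \<open>n \<le> m\<close> by (simp add: integral_unique)
    then show ?thesis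
      unfolding cheb_inner_def
      by (subst set_lebesgue_integral_eq_integral(2)[OF poly_weight_integrable])
  qed
  show ?thesis
    using *[of n m] *[of m n] by (cases "n \<le> m") (auto simp: cheb_inner_commute)
qed

lemma cheb_inner_monic_chebyshev:
  "cheb_inner (monic_chebyshev m) (monic_chebyshev n)
    = (if m = n then (if n = 0 then pi else pi / 2) / (2 ^ (n - 1))\<^sup>2 else 0)"
  unfolding monic_chebyshev_def
  by (simp add: cheb_inner_smult cheb_inner_commute[of "chebyshev_T m" "Polynomial.smult _ _"]
      cheb_inner_chebyshev_T power2_eq_square)

text \<open>
  One step of the expansion in the monic Chebyshev basis; iterating it by induction on the degree
  replaces the expansion itself.
\<close>

lemma poly_split_leading_chebyshev:
  obtains r where "q = r + Polynomial.smult (lead_coeff q) (monic_chebyshev (degree q))"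
    and "r = 0 \<or> degree r < degree q"
proof
  let ?r = "q - Polynomial.smult (lead_coeff q) (monic_chebyshev (degree q))"
  have "degree ?r \<le> degree q"
    by (intro degree_diff_le) auto
  moreover have "coeff ?r (degree q) = 0"
    by simp
  ultimately show "?r = 0 \<or> degree ?r < degree q"
    by (rule eq_zero_or_degree_less)
qed simp

lemma cheb_inner_lower_degree:
  "degree q < n \<Longrightarrow> cheb_inner q (monic_chebyshev n) = 0"
proof (induction "degree q" arbitrary: q rule: less_induct)
  case less
  obtain r where q: "q = r + Polynomial.smult (lead_coeff q) (monic_chebyshev (degree q))"
    and r: "r = 0 \<or> degree r < degree q"
    by (rule poly_split_leading_chebyshev)
  have "cheb_inner r (monic_chebyshev n) = 0"
    using r
  proof
    assume "r = 0"
    then show ?thesis by (simp add: cheb_inner_def)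
  qed (use less in auto)
  then show ?case
    using less.prems
    by (subst q) (simp add: cheb_inner_add cheb_inner_smult cheb_inner_monic_chebyshev)
qed

lemma cheb_inner_leading_eq_0_iff:
  "cheb_inner q (monic_chebyshev (degree q)) = 0 \<longleftrightarrow> q = 0"
proof
  assume 0: "cheb_inner q (monic_chebyshev (degree q)) = 0"
  obtain r where q: "q = r + Polynomial.smult (lead_coeff q) (monic_chebyshev (degree q))"
    and r: "r = 0 \<or> degree r < degree q"
    by (rule poly_split_leading_chebyshev)
  define d where "d = degree q"
  have "cheb_inner r (monic_chebyshev d) = 0"
    using r
  proof
    assume "r = 0"
    then show ?thesis by (simp add: cheb_inner_def)
  qed (simp add: d_def cheb_inner_lower_degree)
  moreover have "cheb_inner q (monic_chebyshev d) = cheb_inner r (monic_chebyshev d)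
      + lead_coeff q * cheb_inner (monic_chebyshev d) (monic_chebyshev d)"
    by (metis q d_def cheb_inner_add cheb_inner_smult)
  ultimately show "q = 0"
    using 0 by (simp add: cheb_inner_monic_chebyshev d_def split: if_splits)
qed (simp add: cheb_inner_def)

text \<open>
  Uniqueness: if \<open>P\<close> agrees with the monic Chebyshev polynomials below \<open>n\<close>, the difference \<open>q\<close> at \<open>n\<close> has
  degree below \<open>n\<close> and is orthogonal to the Chebyshev polynomial of its own degree. That inner product
  is a positive multiple of the leading coefficient of \<open>q\<close>, so \<open>q = 0\<close>.
\<close>

lemma monic_orthogonal_iff: "monic_orthogonal P \<longleftrightarrow> P = monic_chebyshev"
proof
  assume "P = monic_chebyshev"
  then show "monic_orthogonal P"
    by (auto simp: monic_orthogonal_def cheb_inner_monic_chebyshev)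
next
  assume P: "monic_orthogonal P"
  have "P n = monic_chebyshev n" for n
  proof (induction n rule: less_induct)
    case (less n)
    define q where "q = P n - monic_chebyshev n"
    have deg: "degree (P n) = n"
      using P by (simp add: monic_orthogonal_def)
    then have lc: "coeff (P n) n = 1"
      using P by (metis monic_orthogonal_def)
    have "degree q \<le> n"
      unfolding q_def by (intro degree_diff_le) (simp_all add: deg)
    moreover have "coeff q n = 0"
      by (simp add: q_def lc)
    ultimately have "q = 0 \<or> degree q < n"
      by (rule eq_zero_or_degree_less)
    moreover have "q = 0" if "degree q < n"
    proof -
      have "cheb_inner (P n) (P (degree q)) = 0"
        using P that by (simp add: monic_orthogonal_def)
      moreover have "cheb_inner (monic_chebyshev n) (monic_chebyshev (degree q)) = 0"
        using that by (simp add: cheb_inner_monic_chebyshev)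
      ultimately have "cheb_inner (P n - monic_chebyshev n) (monic_chebyshev (degree q)) = 0"
        using less[OF that] by (simp add: cheb_inner_diff)
      then show ?thesis
        by (simp flip: q_def add: cheb_inner_leading_eq_0_iff)
    qed
    ultimately show ?case
      by (auto simp: q_def)
  qed
  then show "P = monic_chebyshev"
    by auto
qed

lemma monic_op_eq: "monic_op = monic_chebyshev"
  by (simp add: monic_op_def monic_orthogonal_iff)

text \<open>
  The orthonormal polynomials are \<open>orth_scale n / sqrt \<pi>\<close> times the Chebyshev polynomials, because
  the squared norm of the latter is \<open>\<pi>\<close> for \<open>n = 0\<close> and \<open>\<pi> / 2\<close> otherwise.
\<close>

definition orth_scale :: "nat \<Rightarrow> real" where
  "orth_scale i = (if i = 0 then 1 else sqrt 2)"

lemma orthonormal_op_eq: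
  "orthonormal_op n = Polynomial.smult (orth_scale n / sqrt pi) (chebyshev_T n)"
proof -
  have "sqrt (cheb_inner (monic_op n) (monic_op n)) = (if n = 0 then sqrt pi else sqrt pi / sqrt 2) / 2 ^ (n - 1)"
    by (simp add: monic_op_eq cheb_inner_monic_chebyshev real_sqrt_divide)
  then show ?thesis
    by (simp add: orthonormal_op_def monic_op_eq monic_chebyshev_def orth_scale_def)
qed

section \<open>The recurrence coefficients\<close>

definition chebyshev_b :: "nat \<Rightarrow> real" where
  "chebyshev_b j = (if j = 0 then pi else if j = 1 then 1 / 2 else 1 / 4)"

lemma integral_cheb_weight: "(LINT t:{-1..1}|lebesgue. cheb_weight t) = pi"
  using cheb_inner_chebyshev_T[of 0 0] by (simp add: cheb_inner_def)

lemma monic_chebyshev_recurrence: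
  "monic_chebyshev (Suc j) = [:0, 1:] * monic_chebyshev j
     - Polynomial.smult (chebyshev_b j) (if j = 0 then 0 else monic_chebyshev (j - 1))"
proof (cases j)
  case (Suc i)
  show ?thesis
    by (rule poly_eqI, cases i)
       (auto simp: Suc monic_chebyshev_def chebyshev_b_def coeff_pCons field_simps split: nat.split)
qed (simp add: monic_chebyshev_def)

text \<open>
  Subtracting two recurrences leaves a relation \<open>(a j - a' j) M j + (b j - b' j) M (j - 1) = 0\<close> between
  monic polynomials of consecutive degrees; comparing the coefficients of index \<open>j\<close> and \<open>j - 1\<close> gives
  uniqueness. At \<open>j = 0\<close> the second term is absent, and \<open>b 0\<close> is fixed by the integral of the weight.
\<close>

lemma three_term_recurrence_iff:
  "three_term_recurrence a b \<longleftrightarrow> a = (\<lambda>j. 0) \<and> b = chebyshev_b"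
proof
  assume "a = (\<lambda>j. 0) \<and> b = chebyshev_b"
  then show "three_term_recurrence a b"
    using monic_chebyshev_recurrence
    by (simp add: three_term_recurrence_def integral_cheb_weight monic_op_eq) (simp add: chebyshev_b_def)
next
  assume ab: "three_term_recurrence a b"
  define M where "M = monic_chebyshev"
  define L where "L j = (if j = 0 then 0 else M (j - 1))" for j
  have L0: "coeff (L j) j = 0" for j
    unfolding L_def M_def by (auto intro: coeff_eq_0)
  have diff: "Polynomial.smult (a j) (M j) + Polynomial.smult (b j - chebyshev_b j) (L j) = 0" for j
  proof -
    have "M (Suc j) = [:- a j, 1:] * M j - Polynomial.smult (b j) (L j)"
      using ab by (auto simp: three_term_recurrence_def monic_op_eq M_def L_def)
    moreover have "M (Suc j) = [:0, 1:] * M j - Polynomial.smult (chebyshev_b j) (L j)"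
      unfolding M_def L_def by (rule monic_chebyshev_recurrence)
    ultimately show ?thesis
      by (simp add: smult_diff_left algebra_simps)
  qed
  have a: "a j = 0" for j
    using arg_cong[OF diff[of j], of "\<lambda>p. coeff p j"] L0[of j] by (simp add: M_def)
  have "b j = chebyshev_b j" for j
  proof (cases j)
    case 0
    then show ?thesis
      using ab by (simp add: three_term_recurrence_def integral_cheb_weight chebyshev_b_def)
  next
    case (Suc i)
    then show ?thesis
      using arg_cong[OF diff[of j], of "\<lambda>p. coeff p i"] a[of j] by (simp add: M_def L_def)
  qed
  then show "a = (\<lambda>j. 0) \<and> b = chebyshev_b"
    using a by auto
qed

lemma rec_coeffs_eq: "rec_coeffs = (\<lambda>j. 0, chebyshev_b)"
  unfolding rec_coeffs_def
  by (rule the_equality) (auto simp: three_term_recurrence_iff prod_eq_iff)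

lemma rec_a_eq: "rec_a j = 0" and rec_b_eq: "rec_b = chebyshev_b"
  by (simp_all add: rec_a_def rec_b_def rec_coeffs_eq)

section \<open>Midpoint and trapezoidal sums of cosines\<close>

text \<open>
  Multiplication by \<open>2 sin \<phi>\<close> turns each cosine into a difference of sines, and the sum telescopes.
\<close>

lemma sin_mult_midpoint_sum:
  "2 * sin \<phi> * (\<Sum>k<n. cos (real (2 * k + 1) * \<phi>)) = sin (real (2 * n) * \<phi>)"
proof (induction n)
  case (Suc n)
  define x where "x = real (2 * n + 1) * \<phi>"
  have "sin (real (2 * n) * \<phi>) = sin (x - \<phi>)" "sin (real (2 * Suc n) * \<phi>) = sin (x + \<phi>)"
    by (simp_all add: x_def algebra_simps)
  moreover have "sin (x + \<phi>) = sin (x - \<phi>) + 2 * sin \<phi> * cos x"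
    by (simp add: sin_add sin_diff)
  ultimately show ?case
    using Suc by (simp only: sum.lessThan_Suc distrib_left flip: x_def)
qed simp

definition gauss_angle :: "nat \<Rightarrow> nat \<Rightarrow> real" where
  "gauss_angle n k = real (2 * k + 1) * pi / real (2 * n)"

definition anti_gauss_angle :: "nat \<Rightarrow> nat \<Rightarrow> real" where
  "anti_gauss_angle n k = real k * pi / real n"

text \<open>
  The Gauss nodes are the midpoints of \<open>n\<close> equal subintervals of \<open>[0, \<pi>]\<close> in the angle. The telescoped sum
  vanishes as long as \<open>sin (i \<pi> / (2 n))\<close> does not; in the remaining case \<open>i = 2 n m\<close>, the function
  \<open>cos (i \<theta>)\<close> takes the same value \<open>(-1) ^ m\<close> at every midpoint.
\<close>

lemma midpoint_sum:
  assumes "n \<ge> 1"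
  shows "(\<Sum>k<n. cos (real i * gauss_angle n k)) = (if 2 * n dvd i then (-1) ^ (i div (2 * n)) * real n else 0)"
proof (cases "2 * n dvd i")
  case True
  then obtain m where m: "i = 2 * n * m" ..
  have "cos (real i * gauss_angle n k) = (-1) ^ m" for k
  proof -
    have "real i * gauss_angle n k = real (m * (2 * k + 1)) * pi"
      using assms by (simp add: m gauss_angle_def distrib_left)
    then have "cos (real i * gauss_angle n k) = ((-1) ^ (2 * k + 1)) ^ m"
      by (simp only: cos_npi power_mult[symmetric] mult.commute[of m])
    then show ?thesis
      by simp
  qed
  then show ?thesis
    using assms m by simp
next
  case False
  define \<phi> where "\<phi> = real i * pi / real (2 * n)"
  have "sin \<phi> \<noteq> 0"
  proof
    assume "sin \<phi> = 0"
    then obtain z :: int where "\<phi> = of_int z * pi"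
      using sin_zero_iff_int2 by blast
    then have "real i = of_int z * real (2 * n)"
      using assms by (simp add: \<phi>_def field_simps)
    then have "int i = z * int (2 * n)"
      by (metis of_int_eq_iff of_int_mult of_int_of_nat_eq)
    then have "int (2 * n) dvd int i"
      by simp
    then show False
      using False by (simp only: of_nat_dvd_iff)
  qed
  moreover have "sin (real (2 * n) * \<phi>) = 0"
    using assms by (simp add: \<phi>_def)
  ultimately have "(\<Sum>k<n. cos (real (2 * k + 1) * \<phi>)) = 0"
    using sin_mult_midpoint_sum[of \<phi> n] by simp
  then show ?thesis
    using False by (simp add: \<phi>_def gauss_angle_def mult_ac)
qed

definition endpoint_weight :: "nat \<Rightarrow> nat \<Rightarrow> real" where
  "endpoint_weight n k = (if k = 0 \<or> k = n then 1 / 2 else 1)"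

lemma trapezoid_eq_averages:
  assumes "n \<ge> 1"
  shows "(\<Sum>k\<le>n. endpoint_weight n k * g k) = (\<Sum>k<n. (g k + g (Suc k)) / 2)"
proof -
  obtain m where n: "n = Suc m"
    using assms by (cases n) auto
  have "(\<Sum>k\<le>n. endpoint_weight n k * g k) = g 0 / 2 + (\<Sum>k<m. endpoint_weight n (Suc k) * g (Suc k)) + g n / 2"
    unfolding n lessThan_Suc_atMost[symmetric]
    by (subst sum.lessThan_Suc, subst sum.lessThan_Suc_shift) (simp add: endpoint_weight_def)
  also have "(\<Sum>k<m. endpoint_weight n (Suc k) * g (Suc k)) = (\<Sum>k<m. g (Suc k))"
    by (rule sum.cong) (auto simp: endpoint_weight_def n)
  also have "g 0 / 2 + (\<Sum>k<m. g (Suc k)) + g n / 2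
      = ((g 0 + (\<Sum>k<m. g (Suc k))) + ((\<Sum>k<m. g (Suc k)) + g n)) / 2"
    by (simp add: field_simps)
  also have "g 0 + (\<Sum>k<m. g (Suc k)) = (\<Sum>k<n. g k)"
    by (simp add: n sum.lessThan_Suc_shift del: sum.lessThan_Suc)
  also have "(\<Sum>k<m. g (Suc k)) + g n = (\<Sum>k<n. g (Suc k))"
    by (simp add: n)
  finally show ?thesis
    by (simp add: sum.distrib sum_divide_distrib[symmetric])
qed

text \<open>
  The anti-Gauss nodes are the end points of those subintervals. Averaging \<open>cos (i \<theta>)\<close> over the two end
  points of a subinterval multiplies the midpoint value by \<open>cos (i \<pi> / (2 n))\<close>. So the trapezoidal sum is
  that factor times the midpoint sum, and at \<open>i = 2 n m\<close> the two signs \<open>(-1) ^ m\<close> cancel.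
\<close>

lemma trapezoid_sum:
  assumes "n \<ge> 1"
  shows "(\<Sum>k\<le>n. endpoint_weight n k * cos (real i * anti_gauss_angle n k)) = (if 2 * n dvd i then real n else 0)"
proof -
  define \<phi> where "\<phi> = real i * pi / real (2 * n)"
  have "(cos (real i * anti_gauss_angle n k) + cos (real i * anti_gauss_angle n (Suc k))) / 2
      = cos \<phi> * cos (real i * gauss_angle n k)" for k
  proof -
    have "real i * anti_gauss_angle n k = real i * gauss_angle n k - \<phi>"
      "real i * anti_gauss_angle n (Suc k) = real i * gauss_angle n k + \<phi>"
      using assms by (simp_all add: anti_gauss_angle_def gauss_angle_def \<phi>_def field_simps)
    then show ?thesis
      by (simp add: cos_add cos_diff)
  qed
  then have "(\<Sum>k\<le>n. endpoint_weight n k * cos (real i * anti_gauss_angle n k))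
      = cos \<phi> * (\<Sum>k<n. cos (real i * gauss_angle n k))"
    by (simp add: trapezoid_eq_averages[OF assms] sum_distrib_left)
  also have "\<dots> = (if 2 * n dvd i then real n else 0)"
  proof (cases "2 * n dvd i")
    case True
    then obtain m where m: "i = 2 * n * m" ..
    have "\<phi> = real m * pi"
      using assms by (simp add: \<phi>_def m)
    then have cos: "cos \<phi> = (-1) ^ m"
      by simp
    have mid: "(\<Sum>k<n. cos (real i * gauss_angle n k)) = (-1) ^ m * real n"
      unfolding midpoint_sum[OF assms] using assms m by simp
    show ?thesis
      unfolding cos mid using True by (simp flip: mult.assoc power_mult_distrib)
  qed (simp add: midpoint_sum[OF assms])
  finally show ?thesis .
qed

text \<open>
  This single identity evaluates both families of weights: for \<open>cos (n \<theta>) = 0\<close> the left-hand side is the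
  reciprocal Christoffel number up to the factor \<open>\<pi>\<close>, and for \<open>sin (n \<theta>) = 0\<close> it is the squared length of the
  eigenvector of the anti-Gauss matrix. It follows from \<open>2 * (cos x)\<^sup>2 = 1 + cos (2 x)\<close>; the end
  weights \<open>1 / 2\<close> account for \<open>orth_scale 0 = 1\<close> and for the coefficient \<open>1\<close> of the last square.
\<close>

lemma sum_squares_eq_trapezoid:
  assumes "n \<ge> 1"
  shows "(\<Sum>j<n. (orth_scale j * cos (real j * \<theta>))\<^sup>2) + (cos (real n * \<theta>))\<^sup>2
    = real n + (\<Sum>j\<le>n. endpoint_weight n j * cos (real j * (2 * \<theta>)))"
proof -
  have double: "2 * (cos (real j * \<theta>))\<^sup>2 = 1 + cos (real j * (2 * \<theta>))" for j
    using cos_double_cos[of "real j * \<theta>"] by (simp add: mult_ac)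
  have "(\<Sum>j<n. (orth_scale j * cos (real j * \<theta>))\<^sup>2) + (cos (real n * \<theta>))\<^sup>2
      = (\<Sum>j\<le>n. endpoint_weight n j * (2 * (cos (real j * \<theta>))\<^sup>2))"
    using assms unfolding lessThan_Suc_atMost[symmetric] sum.lessThan_Suc
    by (intro arg_cong2[where f="(+)"] sum.cong)
       (auto simp: endpoint_weight_def orth_scale_def power_mult_distrib)
  also have "\<dots> = (\<Sum>j\<le>n. endpoint_weight n j * 1) + (\<Sum>j\<le>n. endpoint_weight n j * cos (real j * (2 * \<theta>)))"
    unfolding double by (simp add: distrib_left sum.distrib)
  also have "(\<Sum>j\<le>n. endpoint_weight n j * 1) = real n"
    unfolding trapezoid_eq_averages[OF assms] by simp
  finally show ?thesis .
qed

section \<open>Nodes of the Gauss and anti-Gauss rules\<close>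

lemma poly_roots_eq_image:
  fixes p :: "'a :: idom poly"
  assumes "p \<noteq> 0" "finite K" "degree p \<le> card K" "inj_on g K" "\<And>k. k \<in> K \<Longrightarrow> poly p (g k) = 0"
  shows "{x. poly p x = 0} = g ` K"
proof (rule sym, rule card_seteq)
  show "card {x. poly p x = 0} \<le> card (g ` K)"
    using card_poly_roots_bound[OF \<open>p \<noteq> 0\<close>] assms(3,4) by (simp add: card_image)
qed (use assms poly_roots_finite in auto)

lemma cos_gauss_angle: 
  assumes "n \<ge> 1" shows "cos (real n * gauss_angle n k) = 0"
proof -
  have "real n * gauss_angle n k = real k * pi + pi / 2"
    using assms by (simp add: gauss_angle_def field_simps)
  then show ?thesis
    by (simp add: cos_add)
qed

lemma sin_anti_gauss_angle:
  assumes "n \<ge> 1" shows "sin (real n * anti_gauss_angle n k) = 0"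
  using assms by (simp add: anti_gauss_angle_def)

lemma inj_on_cos_comp:
  assumes "\<And>k. k \<in> K \<Longrightarrow> g k \<in> {0..pi}" "inj_on g K"
  shows "inj_on (\<lambda>k. cos (g k)) K"
  using assms cos_inj_pi unfolding inj_on_def by (metis atLeastAtMost_iff)

lemma inj_on_cos_gauss_angle:
  assumes "n \<ge> 1" shows "inj_on (\<lambda>k. cos (gauss_angle n k)) {..<n}"
proof (rule inj_on_cos_comp)
  fix k assume "k \<in> {..<n}"
  then have "real (2 * k + 1) \<le> real (2 * n)"
    by simp
  then show "gauss_angle n k \<in> {0..pi}"
    using assms by (simp add: gauss_angle_def divide_le_eq mult.commute)
qed (use assms in \<open>auto simp: inj_on_def gauss_angle_def\<close>)

lemma inj_on_cos_anti_gauss_angle: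
  assumes "n \<ge> 1" shows "inj_on (\<lambda>k. cos (anti_gauss_angle n k)) {..n}"
  by (rule inj_on_cos_comp)
     (use assms in \<open>auto simp: inj_on_def anti_gauss_angle_def divide_le_eq mult.commute\<close>)

lemma gauss_nodes_eq:
  assumes "n \<ge> 1"
  shows "gauss_nodes n = (\<lambda>k. cos (gauss_angle n k)) ` {..<n}"
  unfolding gauss_nodes_def monic_op_eq
proof (rule poly_roots_eq_image)
  show "monic_chebyshev n \<noteq> 0"
    using coeff_monic_chebyshev[of n] by fastforce
  show "inj_on (\<lambda>k. cos (gauss_angle n k)) {..<n}"
    by (rule inj_on_cos_gauss_angle[OF assms])
  show "degree (monic_chebyshev n) \<le> card {..<n}"
    by simp
qed (auto simp: monic_chebyshev_def poly_chebyshev_T_cos cos_gauss_angle[OF assms])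

text \<open>
  The formula also holds at \<open>n = 1\<close>, where both \<open>b 1 = 1 / 2\<close> and the normalisation of the constant
  polynomial deviate from the general pattern.
\<close>

lemma anti_gauss_poly_eq:
  assumes "n \<ge> 1"
  shows "monic_op (n + 1) - Polynomial.smult (rec_b n) (monic_op (n - 1))
    = Polynomial.smult (1 / 2 ^ n) (chebyshev_T (n + 1) - chebyshev_T (n - 1))"
proof (cases "n = 1")
  case False
  then obtain m where "n = Suc (Suc m)"
    using assms by (metis One_nat_def not0_implies_Suc not_one_le_zero)
  then show ?thesis
    by (simp add: monic_op_eq rec_b_eq monic_chebyshev_def chebyshev_b_def smult_diff_right
        del: chebyshev_T.simps)
qed (simp add: monic_op_eq rec_b_eq monic_chebyshev_def chebyshev_b_def smult_diff_right numeral_poly)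

text \<open>
  The nodal polynomial at \<open>cos \<theta>\<close> is a multiple of
  \<open>cos ((n + 1) \<theta>) - cos ((n - 1) \<theta>) = - 2 sin (n \<theta>) sin \<theta>\<close>.
\<close>

lemma anti_gauss_nodes_eq:
  assumes "n \<ge> 1"
  shows "anti_gauss_nodes n = (\<lambda>k. cos (anti_gauss_angle n k)) ` {..n}"
  unfolding anti_gauss_nodes_def
proof (rule poly_roots_eq_image)
  let ?p = "monic_op (n + 1) - Polynomial.smult (rec_b n) (monic_op (n - 1))"
  have "coeff (monic_op (n - 1)) (n + 1) = 0"
    unfolding monic_op_eq by (rule coeff_eq_0) auto
  then have "coeff ?p (n + 1) = 1"
    by (simp add: monic_op_eq del: One_nat_def add_Suc_right)
  then show "?p \<noteq> 0"
    by (metis coeff_0 zero_neq_one)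
  have "degree ?p \<le> n + 1"
    by (intro degree_diff_le order_trans[OF degree_smult_le]) (auto simp: monic_op_eq)
  then show "degree ?p \<le> card {..n}"
    by simp
  show "poly ?p (cos (anti_gauss_angle n k)) = 0" for k
  proof -
    let ?t = "anti_gauss_angle n k"
    have "cos (real (n + 1) * ?t) = cos (real n * ?t + ?t)" "cos (real (n - 1) * ?t) = cos (real n * ?t - ?t)"
      using assms by (simp_all add: algebra_simps of_nat_diff)
    then show ?thesis
      unfolding anti_gauss_poly_eq[OF assms] poly_smult poly_diff poly_chebyshev_T_cos
      by (simp only: cos_add cos_diff) (simp add: sin_anti_gauss_angle[OF assms])
  qed
qed (use inj_on_cos_anti_gauss_angle[OF assms] in auto)

section \<open>Weights of the Gauss and anti-Gauss rules\<close>

lemma christoffel_eq: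
  assumes "n \<ge> 1"
  shows "christoffel n (cos (gauss_angle n k)) = pi / real n"
proof -
  let ?t = "gauss_angle n k"
  have "real j * (2 * ?t) = real (2 * k + 1) * anti_gauss_angle n j" for j
    using assms by (simp add: gauss_angle_def anti_gauss_angle_def field_simps)
  then have "(\<Sum>j\<le>n. endpoint_weight n j * cos (real j * (2 * ?t)))
      = (\<Sum>j\<le>n. endpoint_weight n j * cos (real (2 * k + 1) * anti_gauss_angle n j))"
    by (simp only:)
  also have "\<dots> = 0"
    unfolding trapezoid_sum[OF assms] using dvd_mult_left[of 2 n "2 * k + 1"] by auto
  finally have "(\<Sum>j<n. (orth_scale j * cos (real j * ?t))\<^sup>2) = real n"
    using sum_squares_eq_trapezoid[OF assms, of ?t] cos_gauss_angle[OF assms] by simp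
  moreover have "(\<Sum>j<n. (poly (orthonormal_op j) (cos ?t))\<^sup>2)
      = (\<Sum>j<n. (orth_scale j * cos (real j * ?t))\<^sup>2) / pi"
    by (simp add: orthonormal_op_eq poly_chebyshev_T_cos power_divide sum_divide_distrib power_mult_distrib)
  ultimately show ?thesis
    by (simp add: christoffel_def)
qed

definition anti_gauss_offdiag :: "nat \<Rightarrow> nat \<Rightarrow> real" where
  "anti_gauss_offdiag n i = (if i = n then sqrt (2 * rec_b n) else sqrt (rec_b i))"

text \<open>
  The eigenvector for \<open>cos \<theta>\<close>: proportional to the values of the orthonormal polynomials, with the last entry
  divided by \<open>sqrt 2\<close> to balance the doubled last recurrence coefficient.
\<close>

definition anti_gauss_vec :: "nat \<Rightarrow> real \<Rightarrow> nat \<Rightarrow> real" where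
  "anti_gauss_vec n \<theta> j = (if j = n then 1 else orth_scale j) * cos (real j * \<theta>)"

lemma anti_gauss_matrix_mult_vec:
  assumes "i \<le> n" "dim_vec v = n + 1"
  shows "vec_index (anti_gauss_matrix n *\<^sub>v v) i
    = (if 0 < i then anti_gauss_offdiag n i * vec_index v (i - 1) else 0)
    + (if i < n then anti_gauss_offdiag n (i + 1) * vec_index v (i + 1) else 0)"
proof -
  have "vec_index (anti_gauss_matrix n *\<^sub>v v) i
      = (\<Sum>j\<in>{0..<n + 1}. anti_gauss_matrix n $$ (i, j) * vec_index v j)"
    using assms by (simp add: anti_gauss_matrix_def scalar_prod_def del: sum.op_ivl_Suc)
  also have "\<dots> = (\<Sum>j\<in>{0..<n + 1}.
      (if j = i - 1 then if 0 < i then anti_gauss_offdiag n i * vec_index v (i - 1) else 0 else 0)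
    + (if j = i + 1 then anti_gauss_offdiag n (i + 1) * vec_index v (i + 1) else 0))"
    using assms
    by (intro sum.cong refl) (auto simp: anti_gauss_matrix_def rec_a_eq anti_gauss_offdiag_def)
  finally show ?thesis
    using assms by (simp add: sum.distrib del: sum.op_ivl_Suc)
qed

text \<open>
  Row \<open>i\<close> is the addition theorem \<open>cos ((i - 1) \<theta>) + cos ((i + 1) \<theta>) = 2 cos \<theta> cos (i \<theta>)\<close>. In the last row
  only \<open>cos ((n - 1) \<theta>)\<close> is present; it equals \<open>cos \<theta> cos (n \<theta>)\<close> because \<open>sin (n \<theta>) = 0\<close>.
\<close>

lemma anti_gauss_vec_row:
  assumes "n \<ge> 1" "sin (real n * \<theta>) = 0" "i \<le> n"
  shows "(if 0 < i then anti_gauss_offdiag n i * anti_gauss_vec n \<theta> (i - 1) else 0)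
    + (if i < n then anti_gauss_offdiag n (i + 1) * anti_gauss_vec n \<theta> (i + 1) else 0)
    = cos \<theta> * anti_gauss_vec n \<theta> i"
proof -
  define r where "r j = (if j = n then 1 else orth_scale j)" for j
  have half: "sqrt (1 / 2) = sqrt 2 / 2" "sqrt (1 / 4) = 1 / 2" "sqrt (1 / 2) * sqrt 2 = 1"
    using real_sqrt_divide[of 1 4]
    by (simp_all add: real_sqrt_divide real_div_sqrt field_simps)
  \<comment> \<open>The scaling \<open>r\<close> undoes the symmetrisation of the matrix: after it is moved out, the entries
    are the coefficients of the addition theorem.\<close>
  have lower: "anti_gauss_offdiag n j * r (j - 1) = r j * (if j = n then 1 else 1 / 2)"
    if "0 < j" "j \<le> n" for j
    using that assms(1) half
    by (auto simp: anti_gauss_offdiag_def r_def orth_scale_def rec_b_eq chebyshev_b_def)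
  have upper: "anti_gauss_offdiag n (j + 1) * r (j + 1) = r j * (if j = 0 then 1 else 1 / 2)"
    if "j < n" for j
    using that assms(1) half
    by (auto simp: anti_gauss_offdiag_def r_def orth_scale_def rec_b_eq chebyshev_b_def)
  have vec: "anti_gauss_vec n \<theta> j = r j * cos (real j * \<theta>)" for j
    by (simp add: anti_gauss_vec_def r_def)
  have next_cos: "cos (real (i + 1) * \<theta>) = cos (real i * \<theta>) * cos \<theta> - sin (real i * \<theta>) * sin \<theta>"
    by (simp add: distrib_right cos_add)
  have prev_cos: "cos (real (i - 1) * \<theta>) = cos (real i * \<theta>) * cos \<theta> + sin (real i * \<theta>) * sin \<theta>"
    if "0 < i"
    using that by (simp add: of_nat_diff left_diff_distrib cos_diff)
  have "(if 0 < i then anti_gauss_offdiag n i * anti_gauss_vec n \<theta> (i - 1) else 0)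
      = (if 0 < i then r i * (if i = n then 1 else 1 / 2) * cos (real (i - 1) * \<theta>) else 0)"
    using lower[of i] assms(3) by (simp add: vec flip: mult.assoc)
  moreover have "(if i < n then anti_gauss_offdiag n (i + 1) * anti_gauss_vec n \<theta> (i + 1) else 0)
      = (if i < n then r i * (if i = 0 then 1 else 1 / 2) * cos (real (i + 1) * \<theta>) else 0)"
    using upper[of i] by (simp add: vec flip: mult.assoc del: of_nat_add)
  ultimately show ?thesis
    unfolding vec next_cos using assms prev_cos
    by (cases "i = 0"; cases "i = n") (auto simp: algebra_simps)
qed

text \<open>
  The weight is well defined because the rows of a tridiagonal matrix with nonzero off-diagonal
  determine an eigenvector from its first entry. Any eigenvector is thus a multiple of
  \<open>anti_gauss_vec\<close>, whose first entry is \<open>1\<close>; normalisation makes the squared first entry the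
  reciprocal of the squared length of \<open>anti_gauss_vec\<close>.
\<close>

lemma anti_gauss_weight_eq:
  assumes "n \<ge> 1" "sin (real n * \<theta>) = 0"
  shows "anti_gauss_weight n (cos \<theta>) = pi / (\<Sum>j\<le>n. (anti_gauss_vec n \<theta> j)\<^sup>2)"
proof -
  let ?A = "anti_gauss_matrix n"
  define u where "u = anti_gauss_vec n \<theta>"
  define N where "N = (\<Sum>j\<le>n. (u j)\<^sup>2)"
  have u0: "u 0 = 1"
    using assms(1) by (simp add: u_def anti_gauss_vec_def orth_scale_def)
  have "(u 0)\<^sup>2 \<le> N"
    unfolding N_def by (rule member_le_sum) auto
  then have "N > 0"
    by (simp add: u0)
  have dim: "dim_row ?A = n + 1" "dim_col ?A = n + 1"
    by (simp_all add: anti_gauss_matrix_def)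
  have row: "(if 0 < i then anti_gauss_offdiag n i * u (i - 1) else 0)
      + (if i < n then anti_gauss_offdiag n (i + 1) * u (i + 1) else 0) = cos \<theta> * u i" if "i \<le> n" for i
    unfolding u_def by (rule anti_gauss_vec_row[OF assms that])
  have sq: "scalar_prod v v = (\<Sum>j\<le>n. (vec_index v j)\<^sup>2)" if "dim_vec v = n + 1" for v :: "real vec"
    using that by (simp add: scalar_prod_def power2_eq_square atLeast0LessThan lessThan_Suc_atMost)
  have exist: "\<exists>v. eigenvector ?A v (cos \<theta>) \<and> scalar_prod v v = 1 \<and> pi / N = rec_b 0 * (vec_index v 0)\<^sup>2"
  proof (intro exI conjI)
    define v where "v = vec (n + 1) (\<lambda>j. u j / sqrt N)"
    have v: "vec_index v j = u j / sqrt N" if "j \<le> n" for j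
      using that by (simp add: v_def)
    have dimv: "dim_vec v = n + 1"
      by (simp add: v_def)
    have eig: "?A *\<^sub>v v = cos \<theta> \<cdot>\<^sub>v v"
    proof (rule eq_vecI)
      fix i assume "i < dim_vec (cos \<theta> \<cdot>\<^sub>v v)"
      then have i: "i \<le> n"
        by (simp add: dimv)
      have "vec_index (?A *\<^sub>v v) i = ((if 0 < i then anti_gauss_offdiag n i * u (i - 1) else 0)
          + (if i < n then anti_gauss_offdiag n (i + 1) * u (i + 1) else 0)) / sqrt N"
        using i v by (simp add: anti_gauss_matrix_mult_vec[OF i dimv] add_divide_distrib)
      also have "\<dots> = vec_index (cos \<theta> \<cdot>\<^sub>v v) i"
        unfolding row[OF i] using i v dimv by simp
      finally show "vec_index (?A *\<^sub>v v) i = vec_index (cos \<theta> \<cdot>\<^sub>v v) i" .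
    qed (simp add: dim dimv)
    have "vec_index v 0 \<noteq> 0"
      using v[of 0] u0 \<open>N > 0\<close> by simp
    then have nonzero: "v \<noteq> 0\<^sub>v (n + 1)"
      by auto
    show "eigenvector ?A v (cos \<theta>)"
      unfolding eigenvector_def dim by (intro conjI carrier_vecI dimv nonzero eig)
    have "scalar_prod v v = (\<Sum>j\<le>n. (u j)\<^sup>2 / N)"
      unfolding sq[OF dimv] using \<open>N > 0\<close> by (intro sum.cong) (simp_all add: v power_divide)
    also have "\<dots> = 1"
      using \<open>N > 0\<close> by (simp only: flip: sum_divide_distrib N_def) simp
    finally show "scalar_prod v v = 1" .
    show "pi / N = rec_b 0 * (vec_index v 0)\<^sup>2"
      using \<open>N > 0\<close> v[of 0] by (simp add: u0 power_divide rec_b_eq chebyshev_b_def)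
  qed
  have unique: "c = pi / N"
    if ex: "\<exists>v. eigenvector ?A v (cos \<theta>) \<and> scalar_prod v v = 1 \<and> c = rec_b 0 * (vec_index v 0)\<^sup>2" for c
  proof -
    obtain w where w: "eigenvector ?A w (cos \<theta>)" "scalar_prod w w = 1" and c: "c = rec_b 0 * (vec_index w 0)\<^sup>2"
      using ex by blast
    have dimw: "dim_vec w = n + 1" and eq: "?A *\<^sub>v w = cos \<theta> \<cdot>\<^sub>v w"
      using w(1) by (auto simp: eigenvector_def dim)
    have roww: "(if 0 < i then anti_gauss_offdiag n i * vec_index w (i - 1) else 0)
      + (if i < n then anti_gauss_offdiag n (i + 1) * vec_index w (i + 1) else 0) = cos \<theta> * vec_index w i"
      if "i \<le> n" for i
      using that arg_cong[OF eq, of "\<lambda>v. vec_index v i"]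
      by (simp add: anti_gauss_matrix_mult_vec[OF that dimw] dimw)
    define w0 where "w0 = vec_index w 0"
    have w_u: "vec_index w j = w0 * u j" if "j \<le> n" for j
      using that
    proof (induction j rule: less_induct)
      case (less j)
      show ?case
      proof (cases j)
        case (Suc i)
        then have i: "i \<le> n" "i < n" "i < j"
          using less.prems by auto
        have pos: "anti_gauss_offdiag n (i + 1) \<noteq> 0"
          by (simp add: anti_gauss_offdiag_def rec_b_eq chebyshev_b_def)
        have wi: "vec_index w i = w0 * u i"
          using less i by simp
        have wp: "0 < i \<Longrightarrow> vec_index w (i - 1) = w0 * u (i - 1)"
          using less i by simp
        have "anti_gauss_offdiag n (i + 1) * vec_index w (i + 1)
            = cos \<theta> * vec_index w i - (if 0 < i then anti_gauss_offdiag n i * vec_index w (i - 1) else 0)"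
          using roww[OF i(1)] i(2) by (auto simp: algebra_simps)
        also have "\<dots> = w0 *
            (cos \<theta> * u i - (if 0 < i then anti_gauss_offdiag n i * u (i - 1) else 0))"
          using wi wp by (auto simp: algebra_simps)
        also have "cos \<theta> * u i - (if 0 < i then anti_gauss_offdiag n i * u (i - 1) else 0)
            = anti_gauss_offdiag n (i + 1) * u (i + 1)"
          using row[OF i(1)] i(2) by (auto simp: algebra_simps)
        finally show ?thesis
          using pos Suc by simp
      qed (simp add: u0 w0_def)
    qed
    have "1 = (\<Sum>j\<le>n. (vec_index w j)\<^sup>2)"
      using w(2) by (simp add: sq[OF dimw])
    also have "\<dots> = (\<Sum>j\<le>n. (w0 * u j)\<^sup>2)"
      by (rule sum.cong) (simp_all add: w_u)
    finally have "1 = (w0)\<^sup>2 * N"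
      by (simp add: N_def power_mult_distrib sum_distrib_left)
    then show ?thesis
      using \<open>N > 0\<close> by (simp add: c rec_b_eq chebyshev_b_def field_simps flip: w0_def)
  qed
  have "anti_gauss_weight n (cos \<theta>) = pi / N"
    unfolding anti_gauss_weight_def by (rule the_equality, rule exist, rule unique)
  then show ?thesis
    by (simp add: N_def u_def)
qed

lemma anti_gauss_weight_node:
  assumes "n \<ge> 1" "k \<le> n"
  shows "anti_gauss_weight n (cos (anti_gauss_angle n k)) = pi / real n * endpoint_weight n k"
proof -
  let ?t = "anti_gauss_angle n k"
  have "(\<Sum>j\<le>n. (anti_gauss_vec n ?t j)\<^sup>2)
      = (\<Sum>j<n. (orth_scale j * cos (real j * ?t))\<^sup>2) + (cos (real n * ?t))\<^sup>2"
    unfolding lessThan_Suc_atMost[symmetric] sum.lessThan_Suc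
    by (intro arg_cong2[where f="(+)"] sum.cong) (auto simp: anti_gauss_vec_def)
  also have "\<dots> = real n + (\<Sum>j\<le>n. endpoint_weight n j * cos (real j * (2 * ?t)))"
    by (rule sum_squares_eq_trapezoid[OF assms(1)])
  also have "(\<Sum>j\<le>n. endpoint_weight n j * cos (real j * (2 * ?t)))
      = (\<Sum>j\<le>n. endpoint_weight n j * cos (real (2 * k) * anti_gauss_angle n j))"
    by (intro sum.cong) (simp_all add: anti_gauss_angle_def field_simps)
  also have "\<dots> = (if k = 0 \<or> k = n then real n else 0)"
    unfolding trapezoid_sum[OF assms(1)] using assms by (auto dest: dvd_imp_le)
  finally show ?thesis
    using assms by (simp add: anti_gauss_weight_eq sin_anti_gauss_angle endpoint_weight_def split: if_splits)
qed

section \<open>The rules on the orthonormal polynomials\<close>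

text \<open>
  The value of an \<open>n\<close>-point Gauss rule (\<open>\<epsilon> = -1\<close>) or \<open>n + 1\<close>-point anti-Gauss rule (\<open>\<epsilon> = 1\<close>) on the
  \<open>i\<close>-th orthonormal polynomial. The degrees \<open>i = 2 n k\<close> are aliased with degree \<open>0\<close>: such a polynomial
  takes a single nonzero value on all nodes. On every other degree the rule agrees with the integral, \<open>0\<close>.
\<close>

definition aliased_moment :: "real \<Rightarrow> nat \<Rightarrow> nat \<Rightarrow> real" where
  "aliased_moment \<epsilon> n i = (if 2 * n dvd i then \<epsilon> ^ (i div (2 * n)) * (sqrt pi * orth_scale i) else 0)"

lemma gauss_moment:
  assumes "n \<ge> 1"
  shows "(\<Sum>x\<in>gauss_nodes n. christoffel n x * poly (orthonormal_op i) x) = aliased_moment (-1) n i"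
proof -
  have "(\<Sum>x\<in>gauss_nodes n. christoffel n x * poly (orthonormal_op i) x)
      = (\<Sum>k<n. pi / real n * (orth_scale i / sqrt pi) * cos (real i * gauss_angle n k))"
    unfolding gauss_nodes_eq[OF assms] sum.reindex[OF inj_on_cos_gauss_angle[OF assms]] o_def
    by (simp add: christoffel_eq[OF assms] orthonormal_op_eq poly_chebyshev_T_cos mult.assoc)
  also have "\<dots> = aliased_moment (-1) n i"
    unfolding sum_distrib_left[symmetric] midpoint_sum[OF assms]
    using assms by (simp add: aliased_moment_def field_simps)
  finally show ?thesis .
qed

lemma anti_gauss_moment:
  assumes "n \<ge> 1"
  shows "(\<Sum>x\<in>anti_gauss_nodes n. anti_gauss_weight n x * poly (orthonormal_op i) x) = aliased_moment 1 n i"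
proof -
  have "(\<Sum>x\<in>anti_gauss_nodes n. anti_gauss_weight n x * poly (orthonormal_op i) x)
      = (\<Sum>k\<le>n. pi / real n * (orth_scale i / sqrt pi) *
          (endpoint_weight n k * cos (real i * anti_gauss_angle n k)))"
    unfolding anti_gauss_nodes_eq[OF assms] sum.reindex[OF inj_on_cos_anti_gauss_angle[OF assms]] o_def
    by (intro sum.cong)
       (simp_all add: anti_gauss_weight_node[OF assms] orthonormal_op_eq poly_chebyshev_T_cos)
  also have "\<dots> = aliased_moment 1 n i"
    unfolding sum_distrib_left[symmetric] trapezoid_sum[OF assms]
    using assms by (simp add: aliased_moment_def field_simps)
  finally show ?thesis .
qed

section \<open>The error of the cubature rules\<close>

lemma has_sum_finite_sum:
  fixes g :: "'a \<Rightarrow> 'b \<Rightarrow> 'c :: topological_comm_monoid_add"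
  assumes "finite X" "\<And>x. x \<in> X \<Longrightarrow> (g x has_sum s x) A"
  shows "((\<lambda>i. \<Sum>x\<in>X. g x i) has_sum (\<Sum>x\<in>X. s x)) A"
  using assms by (induction X rule: finite_induct) (auto intro!: has_sum_add)

text \<open>
  A product rule uses finitely many points, at each of which the expansion converges, so it may be
  applied term by term; on a product of one polynomial in each variable it factorises.
\<close>

lemma has_sum_product_rule:
  assumes "finite X" "finite Y"
    and "\<And>x y. x \<in> X \<Longrightarrow> y \<in> Y \<Longrightarrow> expansion_converges_at f (x, y)"
  shows "((\<lambda>(i, j). exp_coeff f i j * (\<Sum>x\<in>X. u x * poly (orthonormal_op i) x)
                                    * (\<Sum>y\<in>Y. v y * poly (orthonormal_op j) y))
    has_sum (\<Sum>x\<in>X. \<Sum>y\<in>Y. u x * v y * f (x, y))) UNIV"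
proof -
  define p where "p = orthonormal_op"
  have "((\<lambda>(i, j). exp_coeff f i j * poly (p i) x * poly (p j) y) has_sum f (x, y)) UNIV"
    if "x \<in> X" "y \<in> Y" for x y
    using assms(3)[OF that] by (simp add: expansion_converges_at_def Let_def p_def)
  then have "((\<lambda>ij. \<Sum>x\<in>X. \<Sum>y\<in>Y. u x * v y *
        (case ij of (i, j) \<Rightarrow> exp_coeff f i j * poly (p i) x * poly (p j) y))
      has_sum (\<Sum>x\<in>X. \<Sum>y\<in>Y. u x * v y * f (x, y))) UNIV"
    by (intro has_sum_finite_sum has_sum_cmult_right assms(1,2))
  moreover have "(\<Sum>x\<in>X. \<Sum>y\<in>Y. u x * v y * (exp_coeff f i j * poly (p i) x * poly (p j) y))
      = exp_coeff f i j * (\<Sum>x\<in>X. u x * poly (p i) x) * (\<Sum>y\<in>Y. v y * poly (p j) y)" for i j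
    by (simp add: sum_distrib_left sum_distrib_right mult_ac)
  ultimately show ?thesis
    by (simp add: case_prod_unfold p_def)
qed

lemma has_sum_aliased_terms:
  assumes n: "n1 \<ge> 1" "n2 \<ge> 1"
    and sum: "((\<lambda>(i, j). \<alpha> i j * aliased_moment \<epsilon> n1 i * aliased_moment \<epsilon> n2 j) has_sum Q) UNIV"
  shows "((\<lambda>(k, l). \<epsilon> ^ (k + l) * (orth_scale k * orth_scale l * \<alpha> (2 * n1 * k) (2 * n2 * l)))
    has_sum (Q / pi)) UNIV"
proof -
  define h where "h = (\<lambda>(k, l). (2 * n1 * k, 2 * n2 * l))"
  define t where "t = (\<lambda>(i, j). \<alpha> i j * aliased_moment \<epsilon> n1 i * aliased_moment \<epsilon> n2 j)"
  have "inj h"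
    using n by (auto simp: h_def inj_on_def)
  have outside: "t p = 0" if "p \<notin> range h" for p
  proof -
    obtain i j where p: "p = (i, j)"
      by force
    have "\<not> (2 * n1 dvd i \<and> 2 * n2 dvd j)"
      using that by (force simp: p h_def elim!: dvdE)
    then show ?thesis
      by (auto simp: t_def p aliased_moment_def)
  qed
  have mult: "aliased_moment \<epsilon> n (2 * n * k) = \<epsilon> ^ k * (sqrt pi * orth_scale k)" if "n \<ge> 1" for n k
    using that by (simp add: aliased_moment_def orth_scale_def)
  have "(t has_sum Q) (range h)"
    using sum unfolding t_def[symmetric]
    by (subst has_sum_cong_neutral[where g = t and T = UNIV]) (auto intro: outside)
  then have "((t \<circ> h) has_sum Q) UNIV"
    using \<open>inj h\<close> by (simp add: has_sum_reindex)
  moreover have "(t \<circ> h) (k, l)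
      = pi * (\<epsilon> ^ (k + l) * (orth_scale k * orth_scale l * \<alpha> (2 * n1 * k) (2 * n2 * l)))" for k l
  proof -
    have "(t \<circ> h) (k, l) = (sqrt pi * sqrt pi) *
        (\<epsilon> ^ (k + l) * (orth_scale k * orth_scale l * \<alpha> (2 * n1 * k) (2 * n2 * l)))"
      by (simp only: t_def h_def o_apply prod.case mult[OF n(1)] mult[OF n(2)])
         (simp add: power_add mult_ac)
    then show ?thesis
      by simp
  qed
  then have "t \<circ> h = (\<lambda>p. pi * (case p of (k, l) \<Rightarrow>
      \<epsilon> ^ (k + l) * (orth_scale k * orth_scale l * \<alpha> (2 * n1 * k) (2 * n2 * l))))"
    by (auto simp: fun_eq_iff)
  ultimately show ?thesis
    by (simp add: has_sum_cmult_right_iff)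
qed

text \<open>
  The hypothesis implies absolute summability, so the tail left by the indices \<open>(0, 0)\<close>, \<open>(1, 0)\<close> and
  \<open>(0, 1)\<close> is at most the sum of the absolute values. The iterated sums on the right come from
  splitting the remaining indices into \<open>(1, 1)\<close>, two strips of width two and a quadrant.
\<close>

lemma aliased_series_tail_bound:
  fixes a :: "nat \<Rightarrow> nat \<Rightarrow> real"
  assumes \<epsilon>: "\<bar>\<epsilon>\<bar> = 1"
    and S: "((\<lambda>(k, l). \<epsilon> ^ (k + l) * (orth_scale k * orth_scale l * a k l)) has_sum S) UNIV"
  shows "\<bar>S - a 0 0 - \<epsilon> * sqrt 2 * (a 1 0 + a 0 1)\<bar>
    \<le> sqrt 2 * (sqrt 2 * \<bar>a 1 1\<bar>
      + (\<Sum>\<^sub>\<infinity>k\<in>{2..}. \<bar>a k 0\<bar> + sqrt 2 * \<bar>a k 1\<bar>)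
      + sqrt 2 * (\<Sum>\<^sub>\<infinity>k\<in>{2..}. \<Sum>\<^sub>\<infinity>l\<in>{2..}. \<bar>a k l\<bar>)
      + (\<Sum>\<^sub>\<infinity>l\<in>{2..}. \<bar>a 0 l\<bar> + sqrt 2 * \<bar>a 1 l\<bar>))"
proof -
  define t where "t = (\<lambda>(k, l). \<epsilon> ^ (k + l) * (orth_scale k * orth_scale l * a k l))"
  define b where "b = (\<lambda>(k, l). orth_scale k * orth_scale l * \<bar>a k l\<bar>)"
  have abs_t: "norm (t p) = b p" for p
    using \<epsilon> by (simp add: t_def b_def case_prod_unfold abs_mult power_abs orth_scale_def)
  have t_summable: "t summable_on A" for A
    using has_sum_imp_summable[OF S] unfolding t_def[symmetric]
    by (rule summable_on_subset_banach) simp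
  have b_summable: "b summable_on A" for A
    using summable_on_iff_abs_summable_on_real[THEN iffD1, OF t_summable[of A]] by (simp only: abs_t)
  define F :: "(nat \<times> nat) set" where "F = {(0, 0), (1, 0), (0, 1)}"
  define U :: "nat set" where "U = {2..}"
  have cover: "- F = insert (1, 1) (U \<times> {0, 1} \<union> U \<times> U \<union> {0, 1} \<times> U)"
    unfolding F_def U_def by auto
  have "S = infsum t (F \<union> - F)"
    using S unfolding t_def[symmetric] by (simp add: infsumI)
  also have "\<dots> = infsum t F + infsum t (- F)"
    by (rule infsum_Un_disjoint[OF t_summable t_summable]) simp
  also have "infsum t F = a 0 0 + \<epsilon> * sqrt 2 * (a 1 0 + a 0 1)"
    by (simp add: F_def t_def orth_scale_def algebra_simps)
  finally have "\<bar>S - a 0 0 - \<epsilon> * sqrt 2 * (a 1 0 + a 0 1)\<bar> = norm (infsum t (- F))"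
    by simp
  also have "\<dots> \<le> infsum (\<lambda>p. norm (t p)) (- F)"
    by (rule norm_infsum_bound) (simp only: abs_t b_summable)
  also have "\<dots> = infsum b ({(1, 1)} \<union> (U \<times> {0, 1} \<union> U \<times> U \<union> {0, 1} \<times> U))"
    unfolding cover abs_t by simp
  also have "\<dots> = infsum b {(1, 1)} + (infsum b (U \<times> {0, 1}) + infsum b (U \<times> U) + infsum b ({0, 1} \<times> U))"
    by (subst infsum_Un_disjoint[OF b_summable b_summable],
        (auto simp: U_def)[1])+ simp
  also have "infsum b {(1, 1)} = sqrt 2 * (sqrt 2 * \<bar>a 1 1\<bar>)"
    by (simp add: b_def orth_scale_def)
  also have "infsum b (U \<times> {0, 1}) = (\<Sum>\<^sub>\<infinity>k\<in>U. \<Sum>\<^sub>\<infinity>l\<in>{0, 1}. b (k, l))"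
    by (rule infsum_Sigma_banach[OF b_summable, symmetric])
  also have "\<dots> = (\<Sum>\<^sub>\<infinity>k\<in>U. sqrt 2 * (\<bar>a k 0\<bar> + sqrt 2 * \<bar>a k 1\<bar>))"
    by (intro infsum_cong) (auto simp: b_def orth_scale_def U_def algebra_simps)
  also have "infsum b (U \<times> U) = (\<Sum>\<^sub>\<infinity>k\<in>U. \<Sum>\<^sub>\<infinity>l\<in>U. b (k, l))"
    by (rule infsum_Sigma_banach[OF b_summable, symmetric])
  also have "\<dots> = (\<Sum>\<^sub>\<infinity>k\<in>U. \<Sum>\<^sub>\<infinity>l\<in>U. sqrt 2 * (sqrt 2 * \<bar>a k l\<bar>))"
    by (intro infsum_cong) (auto simp: b_def orth_scale_def U_def)
  also have "infsum b ({0, 1} \<times> U) = (\<Sum>\<^sub>\<infinity>k\<in>{0, 1}. \<Sum>\<^sub>\<infinity>l\<in>U. b (k, l))"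
    by (rule infsum_Sigma_banach[OF b_summable, symmetric])
  also have "\<dots> = (\<Sum>\<^sub>\<infinity>l\<in>U. \<Sum>\<^sub>\<infinity>k\<in>{0, 1}. b (k, l))"
    using b_summable by (intro infsum_swap_banach) simp
  also have "\<dots> = (\<Sum>\<^sub>\<infinity>l\<in>U. sqrt 2 * (\<bar>a 0 l\<bar> + sqrt 2 * \<bar>a 1 l\<bar>))"
    by (intro infsum_cong) (auto simp: b_def orth_scale_def U_def algebra_simps)
  finally show ?thesis
    by (simp only: infsum_cmult_right' U_def) (simp only: distrib_left add.assoc)
qed

lemma weighted_integral_eq: "weighted_integral f = pi * exp_coeff f 0 0"
proof -
  have "exp_coeff f 0 0 = (LINT x:square|lebesgue. (1 / pi) * (f x * weight2 x))"
    unfolding exp_coeff_def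
    by (rule arg_cong[where f = "set_lebesgue_integral lebesgue square"])
       (simp add: fun_eq_iff orthonormal_op_eq orth_scale_def flip: mult.assoc)
  also have "\<dots> = 1 / pi * weighted_integral f"
    by (simp add: weighted_integral_def)
  finally show ?thesis
    by simp
qed

text \<open>
  Both cubature rules at once: the sign \<open>\<epsilon>\<close> only affects the leading error term, while the
  remainder has the same bound.
\<close>

lemma rule_error_bound:
  assumes n: "n1 \<ge> 1" "n2 \<ge> 1" and \<epsilon>: "\<bar>\<epsilon>\<bar> = 1"
    and X: "finite X" "\<And>i. (\<Sum>x\<in>X. u x * poly (orthonormal_op i) x) = aliased_moment \<epsilon> n1 i"
    and Y: "finite Y" "\<And>j. (\<Sum>y\<in>Y. v y * poly (orthonormal_op j) y) = aliased_moment \<epsilon> n2 j"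
    and conv: "\<And>x y. x \<in> X \<Longrightarrow> y \<in> Y \<Longrightarrow> expansion_converges_at f (x, y)"
  shows "\<bar>(\<Sum>x\<in>X. \<Sum>y\<in>Y. u x * v y * f (x, y)) - weighted_integral f
      - pi * sqrt 2 * (\<epsilon> * (exp_coeff f (2 * n1) 0 + exp_coeff f 0 (2 * n2)))\<bar>
    \<le> pi * sqrt 2 * abs_theta f n1 n2"
proof -
  define Q where "Q = (\<Sum>x\<in>X. \<Sum>y\<in>Y. u x * v y * f (x, y))"
  have "((\<lambda>(i, j). exp_coeff f i j * aliased_moment \<epsilon> n1 i * aliased_moment \<epsilon> n2 j) has_sum Q) UNIV"
    using has_sum_product_rule[OF X(1) Y(1) conv, of u v] by (simp add: X(2) Y(2) Q_def)
  then have "\<bar>Q / pi - exp_coeff f 0 0 - \<epsilon> * sqrt 2 * (exp_coeff f (2 * n1) 0 + exp_coeff f 0 (2 * n2))\<bar>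
    \<le> sqrt 2 * abs_theta f n1 n2" (is "\<bar>?d\<bar> \<le> _")
    using aliased_series_tail_bound[OF \<epsilon> has_sum_aliased_terms[OF n]] by (simp add: abs_theta_def Let_def)
  then have "pi * \<bar>?d\<bar> \<le> pi * (sqrt 2 * abs_theta f n1 n2)"
    by (rule mult_left_mono) simp
  moreover have "\<bar>Q - weighted_integral f
      - pi * sqrt 2 * (\<epsilon> * (exp_coeff f (2 * n1) 0 + exp_coeff f 0 (2 * n2)))\<bar> = \<bar>pi * ?d\<bar>"
    by (simp add: weighted_integral_eq algebra_simps)
  then have "\<bar>Q - weighted_integral f
      - pi * sqrt 2 * (\<epsilon> * (exp_coeff f (2 * n1) 0 + exp_coeff f 0 (2 * n2)))\<bar> = pi * \<bar>?d\<bar>"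
    by (simp only: abs_mult) simp
  ultimately show ?thesis
    by (simp only: Q_def mult.assoc)
qed

theorem corollary2p4:
  fixes f :: "real \<times> real \<Rightarrow> real" and N1 N2 :: nat
  assumes "set_integrable lebesgue square (\<lambda>x. f x * weight2 x)"
    and "N1 \<ge> 1" and "N2 \<ge> 1"
    and "\<forall>n1\<ge>N1. \<forall>n2\<ge>N2. coeffs_rapidly_vanish f n1 n2"
  shows "\<forall>n1\<ge>N1. \<forall>n2\<ge>N2.
    abs_theta f n1 n2 < \<bar>exp_coeff f (2 * n1) 0 + exp_coeff f 0 (2 * n2)\<bar> \<longrightarrow>
      (gauss_cubature n1 n2 f \<le> weighted_integral f \<and>
       weighted_integral f \<le> anti_gauss_cubature n1 n2 f) \<or>
      (anti_gauss_cubature n1 n2 f \<le> weighted_integral f \<and>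
       weighted_integral f \<le> gauss_cubature n1 n2 f)"
proof (intro allI impI)
  fix n1 n2
  assume "N1 \<le> n1" "N2 \<le> n2"
    and dominant: "abs_theta f n1 n2 < \<bar>exp_coeff f (2 * n1) 0 + exp_coeff f 0 (2 * n2)\<bar>"
  then have n: "n1 \<ge> 1" "n2 \<ge> 1"
    using assms(2,3) by auto
  have conv: "expansion_converges_at f (x, y)"
    if "x \<in> gauss_nodes n1 \<and> y \<in> gauss_nodes n2 \<or> x \<in> anti_gauss_nodes n1 \<and> y \<in> anti_gauss_nodes n2" for x y
    using assms(4) \<open>N1 \<le> n1\<close> \<open>N2 \<le> n2\<close> that by (fastforce simp: coeffs_rapidly_vanish_def)
  have fin: "finite (gauss_nodes m)" "finite (anti_gauss_nodes m)" if "m \<ge> 1" for m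
    by (simp_all add: gauss_nodes_eq[OF that] anti_gauss_nodes_eq[OF that])
  define s where "s = exp_coeff f (2 * n1) 0 + exp_coeff f 0 (2 * n2)"
  define c where "c = pi * sqrt 2"
  have gauss: "\<bar>gauss_cubature n1 n2 f - weighted_integral f - c * (-1 * s)\<bar> \<le> c * abs_theta f n1 n2"
    unfolding gauss_cubature_def s_def c_def
    by (rule rule_error_bound[OF n])
       (simp_all add: gauss_moment[OF n(1)] gauss_moment[OF n(2)] fin[OF n(1)] fin[OF n(2)] conv)
  have anti: "\<bar>anti_gauss_cubature n1 n2 f - weighted_integral f - c * (1 * s)\<bar> \<le> c * abs_theta f n1 n2"
    unfolding anti_gauss_cubature_def s_def c_def
    by (rule rule_error_bound[OF n])
       (simp_all add: anti_gauss_moment[OF n(1)] anti_gauss_moment[OF n(2)] fin[OF n(1)] fin[OF n(2)] conv)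
  \<comment> \<open>The two errors are \<open>- c * s\<close> and \<open>c * s\<close>, up to perturbations smaller than \<open>\<bar>c * s\<bar>\<close>, so they have
    opposite signs.\<close>
  have "c * abs_theta f n1 n2 < c * \<bar>s\<bar>"
    using dominant by (simp add: c_def s_def)
  then have "c * abs_theta f n1 n2 < \<bar>c * s\<bar>"
    by (simp add: abs_mult c_def)
  then show "(gauss_cubature n1 n2 f \<le> weighted_integral f \<and>
       weighted_integral f \<le> anti_gauss_cubature n1 n2 f) \<or>
      (anti_gauss_cubature n1 n2 f \<le> weighted_integral f \<and>
       weighted_integral f \<le> gauss_cubature n1 n2 f)"
    using gauss anti by (cases "c * s \<ge> 0") auto
qed

end
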